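(* Let $p$ be a prime and $q$ a power of $p$. There exist uncountably many $T$-numbers in $\mathbb{F}_q((T^{-1}))$.
   Context: $\mathbb{F}_q$ is the finite field with $q$ elements and $\mathbb{F}_q((T^{-1}))$ is the field of Laurent series in $T^{-1}$ over $\mathbb{F}_q$. For nonzero $\xi=\sum_{n=N}^{\infty}a_nT^{-n}\in\mathbb{F}_q((T^{-1}))$ with $N\in\mathbb{Z}$, $a_n\in\mathbb{F}_q$, $a_N\neq 0$, put $|\xi|:=q^{-N}$, and $|0|:=0$. The height $H(P)$ of a polynomial $P(X)\in(\mathbb{F}_q[T])[X]$ is the maximum of the absolute values of its coefficients. For an integer $n\ge 1$ and $\xi\in\mathbb{F}_q((T^{-1}))$, $w_n(\xi)\in\mathbb{R}\cup\{+\infty\}$ denotes the supremum of the real numbers $w$ such that $0<|P(\xi)|\le H(P)^{-w}$ for infinitely many $P(X)\in(\mathbb{F}_q[T])[X]$ of degree (in $X$) at most $n$. Put $w(\xi):=\limsup_{n\to\infty}w_n(\xi)/n$. The Laurent series $\xi$ is called a $T$-number if $w(\xi)=+\infty$ and $w_n(\xi)<+\infty$ for all integers $n\ge 1$. *)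

theory Defs
  imports
    "HOL-Computational_Algebra.Formal_Laurent_Series"
    "HOL-Computational_Algebra.Primes"
    "HOL-Library.Cardinality"
    "HOL-Library.Extended_Real"
    "HOL-Library.Countable_Set"
begin

text \<open>
  \<open>'a fls\<close> is read as the field of Laurent series in \<open>T^{-1}\<close>: the library variable \<open>fls_X\<close>
  stands for \<open>T^{-1}\<close>, so \<open>fls_X_inv\<close> is \<open>T\<close>, \<open>fls_nth \<xi> n\<close> is the coefficient of \<open>T^{-n}\<close>,
  and \<open>fls_subdegree \<xi>\<close> is the least \<open>n\<close> with a nonzero coefficient.
\<close>

definition laurent_abs :: "'a::{field,finite} fls \<Rightarrow> real" where
  "laurent_abs \<xi> = (if \<xi> = 0 then 0 else real CARD('a) powi (- fls_subdegree \<xi>))"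

definition poly_to_laurent :: "'a::field poly \<Rightarrow> 'a fls" where
  "poly_to_laurent a = poly (map_poly fls_const a) fls_X_inv"

text \<open>
  In \<open>'a poly poly\<close> the outer variable is \<open>X\<close> and the inner variable is \<open>T\<close>.
\<close>

definition eval_laurent :: "'a::field poly poly \<Rightarrow> 'a fls \<Rightarrow> 'a fls" where
  "eval_laurent P \<xi> = poly (map_poly poly_to_laurent P) \<xi>"

definition height :: "'a::{field,finite} poly poly \<Rightarrow> real" where
  "height P = Max ((\<lambda>i. laurent_abs (poly_to_laurent (coeff P i))) ` {..degree P})"

definition mahler_w :: "nat \<Rightarrow> 'a::{field,finite} fls \<Rightarrow> ereal" where
  "mahler_w n \<xi> = Sup {ereal w | w. infinite {P :: 'a poly poly. degree P \<le> n \<and>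
     0 < laurent_abs (eval_laurent P \<xi>) \<and>
     laurent_abs (eval_laurent P \<xi>) \<le> height P powr (- w)}}"

text \<open>The term for \<open>n = 0\<close> is irrelevant to the limes superior.\<close>

definition mahler_w_lim :: "'a::{field,finite} fls \<Rightarrow> ereal" where
  "mahler_w_lim \<xi> = limsup (\<lambda>n. mahler_w n \<xi> / ereal (real n))"

definition T_number :: "'a::{field,finite} fls \<Rightarrow> bool" where
  "T_number \<xi> \<longleftrightarrow> mahler_w_lim \<xi> = \<infinity> \<and> (\<forall>n\<ge>1. mahler_w n \<xi> < \<infinity>)"

end

theory Submission
  imports Defs
begin

text \<open>
  Let \<open>r\<close> be the characteristic and \<open>\<xi> = \<Sum>i\<ge>1. e\<^sub>i T^(-r^i)\<close> with \<open>e\<^sub>i \<in> {0, 1}\<close> depending only on the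
  3-adic valuation of \<open>i\<close>, through a function \<open>f\<close> that is not eventually constant. For \<open>s = 3^a\<close> the
  sequence \<open>e\<close> has arbitrarily late windows \<open>(N, N + 3s)\<close> on which it is \<open>s\<close>-periodic. There
  \<open>\<xi>^(r^s) - \<xi>\<close> has a long gap, and truncating it yields polynomials \<open>T^A X^(r^s) - T^A X - b\<close>
  showing \<open>w\<^sub>n(\<xi>) \<ge> n\<^sup>2 - 1\<close> for \<open>n = r^s\<close>.

  Conversely, a polynomial \<open>P\<close> of degree \<open>\<le> n\<close> has a nonzero multiple \<open>\<Sum>l\<le>n. c\<^sub>l X^(r^l)\<close> whose
  size is a power of the height of \<open>P\<close>. Its value at \<open>\<xi>\<close> is \<open>\<Sum>i. (\<Sum>l. c\<^sub>l e(i - l)) T^(-r^i)\<close> up to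
  finitely many terms, and the blocks do not overlap for large \<open>i\<close>. As \<open>e\<close> satisfies no linear
  recurrence on a window of a length bounded in terms of \<open>n\<close>, the value cannot be too small.
\<close>

unbundle fps_syntax

section \<open>Laurent series and evaluation\<close>

lemma poly_to_laurent_0 [simp]: "poly_to_laurent 0 = 0"
  by (simp add: poly_to_laurent_def)

lemma poly_to_laurent_pCons [simp]:
  "poly_to_laurent (pCons c a) = fls_const c + fls_X_inv * poly_to_laurent a"
  by (simp add: poly_to_laurent_def map_poly_pCons)

lemma poly_to_laurent_add [simp]:
  "poly_to_laurent (a + b) = poly_to_laurent a + poly_to_laurent b"
  by (induction a b rule: poly_induct2) (simp_all add: algebra_simps flip: fls_plus_const)

lemma poly_to_laurent_smult [simp]:
  "poly_to_laurent (smult c a) = fls_const c * poly_to_laurent a"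
  by (induction a) (simp_all add: algebra_simps)

lemma poly_to_laurent_mult [simp]:
  "poly_to_laurent (a * b) = poly_to_laurent a * poly_to_laurent b"
  by (induction a) (simp_all add: algebra_simps)

lemma poly_to_laurent_uminus [simp]: "poly_to_laurent (- a) = - poly_to_laurent a"
  using poly_to_laurent_add[of "- a" a] by (simp add: eq_neg_iff_add_eq_0)

lemma fls_X_inv_times_nth: "(fls_X_inv * f) $$ k = f $$ (k + 1)" for f :: "'a::field fls"
  by (simp add: fls_X_inv_times_conv_shift)

lemma poly_to_laurent_nth: "poly_to_laurent a $$ k = (if k \<le> 0 then coeff a (nat (- k)) else 0)"
proof (induction a arbitrary: k)
  case (pCons c a)
  show ?case
  proof (cases "k = 0")
    case False
    then have "nat (- k) = Suc (nat (- (k + 1)))" if "k < 0"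
      using that by simp
    with False show ?thesis
      by (auto simp: fls_X_inv_times_nth pCons.IH)
  qed (simp add: fls_X_inv_times_nth pCons.IH)
qed simp

lemma poly_to_laurent_eq_0_iff [simp]: "poly_to_laurent a = 0 \<longleftrightarrow> a = 0"
proof
  assume "poly_to_laurent a = 0"
  then have "poly_to_laurent a $$ (- int (degree a)) = 0" by simp
  then show "a = 0" by (simp add: poly_to_laurent_nth)
qed simp

text \<open>This includes \<open>a = 0\<close>, as both the degree and the subdegree of 0 are 0 by
  convention.\<close>

lemma subdegree_poly_to_laurent [simp]: "fls_subdegree (poly_to_laurent a) = - int (degree a)"
proof (cases "a = 0")
  case False
  show ?thesis
    by (rule fls_subdegree_eqI)
       (use False in \<open>auto simp: poly_to_laurent_nth coeff_eq_0\<close>)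
qed simp

lemma laurent_abs_poly_to_laurent:
  "laurent_abs (poly_to_laurent a :: 'a::{field,finite} fls)
     = (if a = 0 then 0 else real CARD('a) ^ degree a)"
  by (simp add: laurent_abs_def)

lemma eval_laurent_0 [simp]: "eval_laurent 0 x = 0"
  by (simp add: eval_laurent_def)

lemma eval_laurent_pCons [simp]:
  "eval_laurent (pCons c P) x = poly_to_laurent c + x * eval_laurent P x"
  by (simp add: eval_laurent_def map_poly_pCons)

lemma eval_laurent_add [simp]:
  "eval_laurent (P + R) x = eval_laurent P x + eval_laurent R x"
  by (induction P R rule: poly_induct2) (simp_all add: algebra_simps)

lemma eval_laurent_smult [simp]:
  "eval_laurent (smult c P) x = poly_to_laurent c * eval_laurent P x"
  by (induction P) (simp_all add: algebra_simps)

lemma eval_laurent_mult [simp]: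
  "eval_laurent (P * R) x = eval_laurent P x * eval_laurent R x"
  by (induction P) (simp_all add: algebra_simps)

lemma eval_laurent_monom [simp]:
  "eval_laurent (monom c k) x = poly_to_laurent c * x ^ k"
  by (induction k) (simp_all add: monom_0 monom_Suc algebra_simps)

lemma eval_laurent_sum [simp]:
  "eval_laurent (sum P A) x = (\<Sum>i\<in>A. eval_laurent (P i) x)"
  by (induction A rule: infinite_finite_induct) simp_all

section \<open>Lower bounds on the valuation\<close>

text \<open>Expresses that the valuation of \<open>x\<close> is at least \<open>m\<close>. Phrasing
  it by coefficients lets 0 satisfy every bound, whereas \<open>fls_subdegree 0\<close> is
  0.\<close>

definition vanishes_below :: "int \<Rightarrow> 'a::zero fls \<Rightarrow> bool" where
  "vanishes_below m x \<longleftrightarrow> (\<forall>k<m. x $$ k = 0)"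

lemma vanishes_below_iff: "vanishes_below m x \<longleftrightarrow> x = 0 \<or> m \<le> fls_subdegree x"
  by (metis fls_eq0_below_subdegree fls_subdegree_geI fls_zero_nth le_less_trans not_le
      vanishes_below_def)

lemma vanishes_below_add: "vanishes_below m x \<Longrightarrow> vanishes_below m y \<Longrightarrow> vanishes_below m (x + y)"
  for x y :: "'a::monoid_add fls"
  by (simp add: vanishes_below_def)

lemma vanishes_below_mult:
  "vanishes_below m x \<Longrightarrow> vanishes_below l y \<Longrightarrow> vanishes_below (m + l) (x * y)"
  for x y :: "'a::field fls"
  by (cases "x = 0 \<or> y = 0") (auto simp: vanishes_below_iff)

text \<open>By the ultrametric inequality, powers of an \<open>x\<close> with absolute value at most
  1 cannot enlarge the coefficients. This later controls the cofactor in an additive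
  multiple.\<close>

lemma vanishes_below_eval_laurent:
  fixes x :: "'a::field fls"
  assumes "\<And>i. degree (coeff P i) \<le> D" "vanishes_below 0 x"
  shows "vanishes_below (- int D) (eval_laurent P x)"
  using assms(1)
proof (induction P)
  case (pCons c P)
  have "degree (coeff P i) \<le> D" for i
    using pCons.prems[of "Suc i"] by simp
  with pCons.IH have "vanishes_below (- int D) (eval_laurent P x)" by blast
  with vanishes_below_mult[OF assms(2)] have "vanishes_below (- int D) (x * eval_laurent P x)"
    by fastforce
  moreover have "vanishes_below (- int D) (poly_to_laurent c)"
    using pCons.prems[of 0] by (simp add: vanishes_below_iff)
  ultimately show ?case by (simp add: vanishes_below_add)
qed (simp add: vanishes_below_def)

lemma one_less_CARD: "1 < CARD('a::{field,finite})"
proof -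
  have "card {0, 1 :: 'a} \<le> CARD('a)" by (rule card_mono) simp_all
  then show ?thesis by simp
qed

lemma laurent_abs_le_iff:
  fixes x :: "'a::{field,finite} fls"
  shows "laurent_abs x \<le> real CARD('a) powr (- b) \<longleftrightarrow> x = 0 \<or> b \<le> real_of_int (fls_subdegree x)"
  using one_less_CARD[where 'a = 'a]
  by (simp add: laurent_abs_def flip: powr_real_of_int')

text \<open>Freshman's dream applied to a truncation of \<open>f\<close>; the rest does not reach degree \<open>k\<close>.\<close>
lemma fps_power_CHAR_power_nth:
  fixes f :: "'a::field fps"
  assumes "prime CHAR('a)" and m: "m = CHAR('a) ^ l"
  shows "fps_nth (f ^ m) k = (if m dvd k then fps_nth f (k div m) ^ m else 0)"
proof -
  have m0: "m > 0" using assms by (simp add: prime_gt_0_nat)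
  let ?c = "\<lambda>i. fps_const (fps_nth f i) * fps_X ^ i"
  have ch: "prime CHAR('a fps)" "m = CHAR('a fps) ^ l" using assms by simp_all
  have cut: "fps_cutoff (Suc k) f = sum ?c {..k}"
    by (rule fps_ext) (simp add: fps_sum_nth fps_X_power_nth if_distrib sum.delta cong: if_cong)
  have "f ^ m = (fps_X ^ Suc k * fps_shift (Suc k) f + sum ?c {..k}) ^ m"
    using fps_shift_cutoff[of "Suc k" f] cut by (simp add: mult.commute)
  also have "\<dots> = (fps_X ^ Suc k * fps_shift (Suc k) f) ^ m + (\<Sum>i\<le>k. ?c i ^ m)"
    by (simp only: freshmans_dream'[OF ch] freshmans_dream_sum'[OF ch])
  also have "fps_nth \<dots> k = (\<Sum>i\<le>k. if k = i * m then fps_nth f i ^ m else 0)"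
  proof -
    have "Suc k \<le> Suc k * m" using m0 by (cases m) auto
    then have "fps_nth ((fps_X ^ Suc k * fps_shift (Suc k) f) ^ m) k = 0"
      by (simp only: power_mult_distrib fps_X_power_mult_nth flip: power_mult) simp
    moreover have "fps_nth (?c i ^ m) k = (if k = i * m then fps_nth f i ^ m else 0)" for i
      by (simp add: power_mult_distrib fps_X_power_nth fps_const_power flip: power_mult)
    ultimately show ?thesis by (simp add: fps_sum_nth)
  qed
  also have "\<dots> = (if m dvd k then fps_nth f (k div m) ^ m else 0)"
  proof (cases "m dvd k")
    case True
    then obtain j where j: "k = m * j" ..
    then have "(\<Sum>i\<le>k. if k = i * m then fps_nth f i ^ m else 0)
      = (\<Sum>i\<le>k. if i = j then fps_nth f i ^ m else 0)"
      using m0 by (intro sum.cong) auto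
    with j m0 show ?thesis by (simp add: sum.delta)
  qed (auto intro!: sum.neutral)
  finally show ?thesis .
qed

section \<open>Lacunary series and their Frobenius powers\<close>

definition lacunary :: "nat \<Rightarrow> (nat \<Rightarrow> bool) \<Rightarrow> 'a::field fls" where
  "lacunary r e = fps_to_fls (Abs_fps (\<lambda>k. if \<exists>i\<ge>1. k = r ^ i \<and> e i then 1 else 0))"

lemma lacunary_nth:
  "lacunary r e $$ k = (if \<exists>i\<ge>1. k = int (r ^ i) \<and> e i then 1 else 0)"
proof -
  have "(\<exists>i\<ge>1. k = int (r ^ i) \<and> e i) \<longleftrightarrow> k \<ge> 0 \<and> (\<exists>i\<ge>1. nat k = r ^ i \<and> e i)"
    by (metis nat_int of_nat_0_le_iff int_nat_eq)
  then show ?thesis unfolding lacunary_def by (auto simp del: of_nat_power)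
qed

text \<open>Frobenius fixes the coefficients 0 and 1 and moves the exponent \<open>r ^ i\<close> to
  \<open>r ^ (i + l)\<close>, so it acts as a shift of \<open>e\<close>. The condition
  \<open>l < i\<close> keeps the first \<open>l\<close> places empty.\<close>

lemma lacunary_power_CHAR:
  assumes "prime CHAR('a)" and r: "r = CHAR('a::field)"
  shows "(lacunary r e :: 'a fls) ^ (r ^ l) = lacunary r (\<lambda>i. l < i \<and> e (i - l))"
proof -
  have r1: "1 < r" using assms prime_gt_1_nat by simp
  have "Abs_fps (\<lambda>k. if \<exists>i\<ge>1. k = r ^ i \<and> e i then 1 else (0::'a)) ^ (r ^ l)
    = Abs_fps (\<lambda>k. if \<exists>i\<ge>1. k = r ^ i \<and> l < i \<and> e (i - l) then 1 else 0)"
  proof (rule fps_ext)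
    fix k
    have "(r ^ l dvd k \<and> (\<exists>i\<ge>1. k div r ^ l = r ^ i \<and> e i)) \<longleftrightarrow>
          (\<exists>i\<ge>1. k = r ^ i \<and> l < i \<and> e (i - l))" (is "?L \<longleftrightarrow> ?R")
    proof
      assume ?L
      then obtain i where "i \<ge> 1" "k = r ^ (i + l)" "e i"
        using r1 by (auto simp: power_add)
      then show ?R by (intro exI[of _ "i + l"]) auto
    next
      assume ?R
      then obtain i where i: "k = r ^ i" "l < i" "e (i - l)" by blast
      have k: "k = r ^ (i - l) * r ^ l" using i by (simp flip: power_add)
      have "r ^ l dvd k" "k div r ^ l = r ^ (i - l)" unfolding k using r1 by simp_all
      with i show ?L by (auto intro!: exI[of _ "i - l"])
    qed
    moreover have "r ^ l > 0" using r1 by simp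
    ultimately show "fps_nth (Abs_fps (\<lambda>k. if \<exists>i\<ge>1. k = r ^ i \<and> e i then 1 else (0::'a)) ^ (r ^ l)) k
      = fps_nth (Abs_fps (\<lambda>k. if \<exists>i\<ge>1. k = r ^ i \<and> l < i \<and> e (i - l) then 1 else 0)) k"
      using fps_power_CHAR_power_nth[OF assms(1), of "r ^ l" l] r
      by (auto simp: power_0_left)
  qed
  then show ?thesis
    unfolding lacunary_def by (simp flip: fps_to_fls_power)
qed

lemma vanishes_below_lacunary: "vanishes_below 0 (lacunary r e)"
  by (auto simp: vanishes_below_def lacunary_nth)

section \<open>Additive multiples of a polynomial\<close>

lemma finite_card_degree_le:
  "finite {p :: 'a::{field,finite} poly. degree p \<le> D} \<and>
   card {p :: 'a poly. degree p \<le> D} = CARD('a) ^ Suc D"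
proof (induction D)
  case 0
  have "{p :: 'a poly. degree p \<le> 0} = (\<lambda>c. [:c:]) ` UNIV"
    by (auto elim: degree_eq_zeroE)
  moreover have "inj (\<lambda>c::'a. [:c:])" by (auto simp: inj_def)
  ultimately show ?case by (simp add: card_image)
next
  case (Suc D)
  have "{p :: 'a poly. degree p \<le> Suc D}
      = (\<lambda>(c, p). pCons c p) ` (UNIV \<times> {p. degree p \<le> D})" (is "?A = ?f ` ?B")
  proof
    show "?A \<subseteq> ?f ` ?B"
    proof
      fix p :: "'a poly" assume p: "p \<in> ?A"
      obtain c p' where "p = pCons c p'" by (cases p)
      with p show "p \<in> ?f ` ?B" by (auto split: if_splits)
    qed
  qed (auto simp: le_SucI)
  moreover have "inj_on ?f ?B" by (auto simp: inj_on_def)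
  ultimately show ?case using Suc by (simp add: card_image card_cartesian_product)
qed

text \<open>A Siegel lemma: there are more vectors \<open>c\<close> of the given size than possible values of the
  linear forms.\<close>
lemma small_solution_linear_system:
  fixes A :: "nat \<Rightarrow> nat \<Rightarrow> 'a::{field,finite} poly"
  assumes A: "\<And>l j. degree (A l j) \<le> E"
  obtains c where "\<And>l. degree (c l) \<le> n * E" "\<exists>l\<le>n. c l \<noteq> 0"
    "\<And>j. j < n \<Longrightarrow> (\<Sum>l\<le>n. c l * A l j) = 0"
proof -
  let ?P = "\<lambda>D. {p :: 'a poly. degree p \<le> D}"
  define V where "V = ({..n} \<rightarrow>\<^sub>E ?P (n * E))"
  define W where "W = ({..<n} \<rightarrow>\<^sub>E ?P (n * E + E))"
  define F where "F c = restrict (\<lambda>j. \<Sum>l\<le>n. c l * A l j) {..<n}" for c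
  have "F ` V \<subseteq> W"
  proof (clarsimp simp: F_def V_def W_def)
    fix c j assume c: "c \<in> {..n} \<rightarrow>\<^sub>E ?P (n * E)"
    show "degree (\<Sum>l\<le>n. c l * A l j) \<le> n * E + E"
    proof (rule degree_sum_le)
      fix l assume "l \<in> {..n}"
      with c have "degree (c l) \<le> n * E" by auto
      with A[of l j] show "degree (c l * A l j) \<le> n * E + E"
        using degree_mult_le[of "c l" "A l j"] by linarith
    qed simp
  qed
  moreover have "finite W" unfolding W_def
    by (intro finite_PiE) (auto simp: finite_card_degree_le)
  moreover have "card W < card V"
  proof -
    \<comment> \<open>The two sides differ by exactly 1: the size \<open>n * E\<close> of the
      unknowns leaves just enough room for the pigeonhole.\<close>
    have "n * Suc (n * E + E) < Suc n * Suc (n * E)" by (simp add: algebra_simps)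
    then have "CARD('a) ^ (Suc (n * E + E) * n) < CARD('a) ^ (Suc (n * E) * Suc n)"
      using one_less_CARD[where 'a = 'a] by (intro power_strict_increasing) (simp_all only: mult.commute)
    then show ?thesis
      unfolding V_def W_def power_mult
      by (simp add: card_PiE finite_card_degree_le del: power_Suc)
  qed
  ultimately have "\<not> inj_on F V"
    by (meson card_inj_on_le leD)
  then obtain c d where cd: "c \<in> V" "d \<in> V" "F c = F d" "c \<noteq> d"
    unfolding inj_on_def by blast
  show thesis
  proof
    \<comment> \<open>The difference of two colliding vectors. It is cut off above \<open>n\<close>
      because members of \<open>V\<close> are \<open>undefined\<close> there, while the degree bound
      is required for every \<open>l\<close>.\<close>
    let ?c = "\<lambda>l. if l \<le> n then c l - d l else 0"
    show "degree (?c l) \<le> n * E" for l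
      using cd(1,2) by (auto simp: V_def intro!: degree_diff_le)
    show "\<exists>l\<le>n. ?c l \<noteq> 0"
    proof (rule ccontr)
      assume "\<not> (\<exists>l\<le>n. ?c l \<noteq> 0)"
      with cd(1,2) have "c = d" unfolding V_def by (intro PiE_ext) auto
      with cd(4) show False by simp
    qed
    show "(\<Sum>l\<le>n. ?c l * A l j) = 0" if "j < n" for j
      using fun_cong[OF cd(3), of j] that by (simp add: F_def algebra_simps sum_subtractf)
  qed
qed

text \<open>Pseudo-division of \<open>X ^ k\<close> by \<open>P\<close>. Passing from
  \<open>k\<close> to \<open>k + 1\<close> multiplies the remainder by \<open>X\<close> and the
  leading coefficient and removes its top term with a multiple of \<open>P\<close>, which costs at
  most \<open>h\<close> in the coefficient degrees.\<close>

lemma monom_pseudo_remainder: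
  fixes P :: "'a::field poly poly"
  assumes d: "degree P > 0" and P: "\<And>i. degree (coeff P i) \<le> h"
  shows "\<exists>S R. monom (lead_coeff P ^ k) k = P * S + R \<and> degree R < degree P \<and>
    (\<forall>i. degree (coeff S i) \<le> k * h) \<and> (\<forall>i. degree (coeff R i) \<le> k * h)"
proof (induction k)
  case 0
  show ?case using d by (intro exI[of _ 0] exI[of _ 1]) (simp add: monom_0 flip: one_pCons)
next
  case (Suc k)
  then obtain S R where IH: "monom (lead_coeff P ^ k) k = P * S + R" "degree R < degree P"
    "\<And>i. degree (coeff S i) \<le> k * h" "\<And>i. degree (coeff R i) \<le> k * h" by blast
  define c where "c = lead_coeff P"
  \<comment> \<open>The coefficient of \<open>X ^ degree P\<close> in \<open>X * R\<close>;
    subtracting \<open>t * P\<close> in \<open>R'\<close> cancels it.\<close>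
  define t where "t = coeff R (degree P - 1)"
  define S' where "S' = smult c (pCons 0 S) + [:t:]"
  define R' where "R' = smult c (pCons 0 R) - smult t P"
  have c: "degree c \<le> h" and t: "degree t \<le> k * h" unfolding c_def t_def by (rule P IH)+
  have mult_le: "degree (u * v) \<le> Suc k * h" if "degree u \<le> h" "degree v \<le> k * h" for u v :: "'a poly"
    using degree_mult_le[of u v] that by simp
  have "monom (c ^ Suc k) (Suc k) = smult c (pCons 0 (monom (c ^ k) k))"
    by (simp add: monom_Suc smult_monom)
  also have "\<dots> = P * S' + R'"
    by (simp add: IH(1)[folded c_def] S'_def R'_def algebra_simps smult_add_right)
  finally have "monom (lead_coeff P ^ Suc k) (Suc k) = P * S' + R'" by (simp add: c_def)
  moreover have "degree R' < degree P"
  proof -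
    have "degree R' \<le> degree P" unfolding R'_def
      by (intro degree_diff_le) (use IH(2) in \<open>auto intro: le_trans[OF degree_smult_le] le_trans[OF degree_pCons_le]\<close>)
    moreover have "coeff R' (degree P) = 0"
      using d by (cases "degree P") (simp_all add: R'_def t_def c_def)
    ultimately show ?thesis
      using d by (metis degree_0 leading_coeff_0_iff le_neq_implies_less)
  qed
  moreover have "degree (coeff S' i) \<le> Suc k * h" for i
  proof -
    have "degree (coeff (pCons 0 S) i) \<le> k * h" using IH(3) by (cases i) auto
    moreover have "degree (coeff [:t:] i) \<le> Suc k * h" using t by (cases i) auto
    ultimately show ?thesis unfolding S'_def
      by (simp only: coeff_add coeff_smult) (intro degree_add_le mult_le c)
  qed
  moreover have "degree (coeff R' i) \<le> Suc k * h" for i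
  proof -
    have "degree (coeff (pCons 0 R) i) \<le> k * h" using IH(4) by (cases i) auto
    then show ?thesis unfolding R'_def using mult_le[OF P t, of i]
      by (simp only: coeff_diff coeff_smult mult.commute[of t])
         (intro degree_diff_le mult_le[OF c])
  qed
  ultimately show ?case by blast
qed

text \<open>The pseudo-remainders of the \<open>n + 1\<close> powers \<open>X ^ (r ^ l)\<close> have
  at most \<open>n\<close> coefficients each. The Siegel lemma yields a small nontrivial relation
  between them, and the same combination of the powers is then divisible by
  \<open>P\<close>.\<close>

lemma additive_multiple:
  fixes P :: "'a::{field,finite} poly poly"
  assumes d: "degree P > 0" "degree P \<le> n" and P: "\<And>i. degree (coeff P i) \<le> h" and r: "r > 0"
  defines "E \<equiv> r ^ n * h"
  obtains c u S where "\<And>l. degree (c l) \<le> n * E" "\<exists>l\<le>n. c l \<noteq> 0" "u \<noteq> 0"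
    "(\<Sum>l\<le>n. monom (u * c l) (r ^ l)) = P * S" "\<And>i. degree (coeff S i) \<le> n * E + E"
proof -
  define v where "v = lead_coeff P"
  have "\<forall>l. \<exists>S R. monom (v ^ (r ^ l)) (r ^ l) = P * S + R \<and> degree R < degree P \<and>
    (\<forall>i. degree (coeff S i) \<le> r ^ l * h) \<and> (\<forall>i. degree (coeff R i) \<le> r ^ l * h)"
    unfolding v_def by (intro allI monom_pseudo_remainder d P)
  then obtain S R where SR: "\<And>l. monom (v ^ (r ^ l)) (r ^ l) = P * S l + R l"
    "\<And>l. degree (R l) < degree P" "\<And>l i. degree (coeff (S l) i) \<le> r ^ l * h"
    "\<And>l i. degree (coeff (R l) i) \<le> r ^ l * h" by metis
  \<comment> \<open>These factors bring all pseudo-divisions to the common multiplier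
    \<open>v ^ (r ^ n)\<close>, so that one bound \<open>E\<close> serves for every
    \<open>l \<le> n\<close>.\<close>
  define w where "w l = v ^ (r ^ n - r ^ l)" for l
  have v: "v \<noteq> 0" "degree v \<le> h" using d P by (auto simp: v_def)
  have w: "degree (w l * z) \<le> E" if "degree z \<le> r ^ l * h" "l \<le> n" for z l
  proof -
    have "degree (w l * z) \<le> (r ^ n - r ^ l) * h + r ^ l * h"
      using degree_mult_le[of "w l" z] that(1) degree_power_le[of v "r ^ n - r ^ l"]
        mult_le_mono2[OF v(2), of "r ^ n - r ^ l"]
      unfolding w_def mult.commute[of "degree v"] by linarith
    also have "\<dots> = E" using power_increasing[of l n r] that r
      by (simp add: E_def flip: add_mult_distrib)
    finally show ?thesis .
  qed
  \<comment> \<open>The case distinction supplies a degree bound for all \<open>l\<close>; beyond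
    \<open>n\<close> the bound \<open>E\<close> on \<open>w l * coeff (R l) j\<close> may
    fail.\<close>
  obtain c where c: "\<And>l. degree (c l) \<le> n * E" "\<exists>l\<le>n. c l \<noteq> 0"
    "\<And>j. j < n \<Longrightarrow> (\<Sum>l\<le>n. c l * (if l \<le> n then w l * coeff (R l) j else 0)) = 0"
    by (rule small_solution_linear_system[of "\<lambda>l j. if l \<le> n then w l * coeff (R l) j else 0" E n])
       (use w SR(4) in auto)
  let ?S = "\<Sum>l\<le>n. smult (c l * w l) (S l)"
  have "(\<Sum>l\<le>n. smult (c l * w l) (R l)) = 0"
  proof (rule poly_eqI)
    fix j
    show "coeff (\<Sum>l\<le>n. smult (c l * w l) (R l)) j = coeff 0 j"
    proof (cases "j < n")
      case True
      then show ?thesis using c(3)[OF True] by (simp add: coeff_sum mult.assoc)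
    next
      case False
      then have "coeff (R l) j = 0" for l
        using SR(2)[of l] d by (intro coeff_eq_0) linarith
      then show ?thesis by (simp add: coeff_sum)
    qed
  qed
  moreover have "monom (v ^ (r ^ n) * c l) (r ^ l)
      = P * smult (c l * w l) (S l) + smult (c l * w l) (R l)" if "l \<le> n" for l
  proof -
    have "v ^ (r ^ n) = w l * v ^ (r ^ l)"
      using power_increasing[of l n r] that r by (simp add: w_def flip: power_add)
    then have "monom (v ^ (r ^ n) * c l) (r ^ l) = smult (c l * w l) (monom (v ^ (r ^ l)) (r ^ l))"
      by (simp add: smult_monom mult_ac)
    then show ?thesis by (simp add: SR(1) smult_add_right)
  qed
  ultimately have "(\<Sum>l\<le>n. monom (v ^ (r ^ n) * c l) (r ^ l)) = P * ?S"
    by (simp add: sum.distrib sum_distrib_left)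
  moreover have "degree (coeff ?S i) \<le> n * E + E" for i
    unfolding coeff_sum
  proof (rule degree_sum_le)
    fix l assume "l \<in> {..n}"
    with w[OF SR(3), of l i] c(1)[of l] degree_mult_le[of "c l" "w l * coeff (S l) i"]
    show "degree (coeff (smult (c l * w l) (S l)) i) \<le> n * E + E"
      by (simp add: mult.assoc)
  qed simp
  ultimately show thesis using v by (intro that[of c "v ^ (r ^ n)" ?S] c) auto
qed

section \<open>Coefficients of an additive polynomial at a lacunary series\<close>

lemma poly_to_laurent_times_nth:
  fixes y :: "'a::field fls"
  assumes "degree c \<le> D"
  shows "(poly_to_laurent c * y) $$ k = (\<Sum>t\<le>D. coeff c t * y $$ (k + int t))"
  using assms
proof (induction c arbitrary: k D)
  case (pCons a c)
  show ?case
  proof (cases D)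
    case 0
    with pCons.prems have "c = 0" by (auto split: if_splits)
    with 0 show ?thesis by simp
  next
    case (Suc D')
    with pCons.prems have "degree c \<le> D'" by (auto split: if_splits)
    from pCons.IH[OF this, of "k + 1"] show ?thesis
      by (simp add: Suc sum.atMost_Suc_shift distrib_right mult.assoc fls_X_inv_times_nth add_ac
          del: sum.atMost_Suc)
  qed
qed simp

text \<open>The neighbouring powers of \<open>r\<close> are at distance at least
  \<open>r ^ (i - 1)\<close> from \<open>r ^ i\<close>, which exceeds \<open>D\<close>.\<close>

lemma power_eq_of_close:
  fixes r i j t t0 D :: nat
  assumes "r > 1" "i \<ge> 1" "D < r ^ (i - 1)" "t \<le> D" "t0 \<le> D" "r ^ i + t = r ^ j + t0"
  shows "j = i"
proof (rule linorder_cases[of i j])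
  assume "i < j"
  then have "r ^ Suc i \<le> r ^ j" using assms(1) by (intro power_increasing) auto
  moreover have "2 * r ^ i \<le> r ^ Suc i" using assms(1) by simp
  moreover have "r ^ (i - 1) \<le> r ^ i" using assms(1) by (intro power_increasing) auto
  ultimately show ?thesis using assms by linarith
next
  assume "j < i"
  then have "r ^ j \<le> r ^ (i - 1)" using assms(1) by (intro power_increasing) auto
  moreover have "2 * r ^ (i - 1) \<le> r ^ i" using assms(1,2) by (cases i) auto
  ultimately show ?thesis using assms by linarith
qed simp

text \<open>Multiplication by \<open>c l\<close> spreads the term at \<open>r ^ i\<close> over the
  exponents \<open>r ^ i - t\<close> with \<open>t \<le> D\<close>. Terms from other powers of
  \<open>r\<close> do not reach this block, so a single coefficient of each \<open>c l\<close> is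
  read off.\<close>

lemma additive_lacunary_nth:
  fixes c :: "nat \<Rightarrow> 'a::field poly"
  assumes r: "prime CHAR('a)" "r = CHAR('a)"
    and c: "\<And>l. degree (c l) \<le> D" and i: "D < r ^ (i - 1)" "n < i" and t0: "t0 \<le> D"
  shows "(\<Sum>l\<le>n. poly_to_laurent (c l) * lacunary r e ^ (r ^ l)) $$ (int (r ^ i) - int t0)
    = (\<Sum>l\<le>n. if e (i - l) then coeff (c l) t0 else 0)"
proof -
  have r1: "r > 1" using r prime_gt_1_nat by simp
  have "(poly_to_laurent (c l) * lacunary r e ^ (r ^ l)) $$ (int (r ^ i) - int t0)
    = (if e (i - l) then coeff (c l) t0 else 0)" if "l \<le> n" for l
  proof -
    have *: "lacunary r (\<lambda>i. l < i \<and> e (i - l)) $$ (int (r ^ i) - int t0 + int t)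
      = (if t = t0 \<and> e (i - l) then 1 else (0::'a))" if t: "t \<le> D" for t
    proof -
      have "int (r ^ i) - int t0 + int t = int (r ^ j) \<longleftrightarrow> r ^ i + t = r ^ j + t0" for j
        by linarith
      moreover have "r ^ i + t = r ^ j + t0 \<longleftrightarrow> j = i \<and> t = t0" for j
        using power_eq_of_close[OF r1 _ i(1) t t0, of j] i(2) by auto
      ultimately show ?thesis
        unfolding lacunary_nth using i(2) \<open>l \<le> n\<close> by auto
    qed
    have "(poly_to_laurent (c l) * lacunary r e ^ (r ^ l)) $$ (int (r ^ i) - int t0)
      = (\<Sum>t\<le>D. coeff (c l) t * (if t = t0 \<and> e (i - l) then 1 else 0))"
      unfolding lacunary_power_CHAR[OF r] poly_to_laurent_times_nth[OF c]
      by (intro sum.cong refl arg_cong2[of _ _ _ _ "(*)"] *) auto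
    also have "\<dots> = (\<Sum>t\<le>D. if t = t0 then if e (i - l) then coeff (c l) t0 else 0 else 0)"
      by (intro sum.cong) auto
    finally show ?thesis using t0 by simp
  qed
  then show ?thesis by (simp add: fls_nth_sum)
qed

section \<open>A lacunary series with a Toeplitz coefficient sequence\<close>

text \<open>Divisibility by \<open>p ^ j\<close> is unaffected for \<open>j \<le> a\<close>, and for
  larger \<open>j\<close> it fails on both sides.\<close>

lemma multiplicity_add_power_mult:
  fixes p x k :: nat
  assumes "\<not> p ^ a dvd x"
  shows "multiplicity p (x + p ^ a * k) = multiplicity p x"
proof (rule multiplicity_cong)
  fix j
  have *: "p ^ a dvd x + p ^ a * k \<longleftrightarrow> p ^ a dvd x"
    by (simp add: dvd_add_left_iff)
  show "p ^ j dvd x + p ^ a * k \<longleftrightarrow> p ^ j dvd x"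
  proof (cases "j \<le> a")
    case True
    then have "p ^ j dvd p ^ a * k" by (simp add: le_imp_power_dvd)
    then show ?thesis by (rule dvd_add_left_iff)
  next
    case False
    then show ?thesis
      using * assms by (meson dvd_trans le_imp_power_dvd nat_le_linear)
  qed
qed

lemma multiplicity_power_mult_eq:
  fixes p m :: nat
  assumes "p > 0" "\<not> p dvd m"
  shows "multiplicity p (p ^ a * m) = a"
  by (rule multiplicity_decomposeI) (use assms in auto)

text \<open>The coefficient sequence is of Toeplitz type: away from the multiples of
  \<open>3 ^ a\<close> it has period \<open>3 ^ a\<close>.\<close>

definition ternary_lacunary :: "(nat \<Rightarrow> bool) \<Rightarrow> 'a::field fls" where
  "ternary_lacunary f = lacunary CHAR('a) (\<lambda>i. f (multiplicity 3 i))"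

lemma lacunary_nth_power:
  assumes "r > 1" "i \<ge> 1"
  shows "lacunary r e $$ int (r ^ i) = (if e i then 1 else 0)"
  using assms unfolding lacunary_nth by auto

text \<open>The only multiple of \<open>3 ^ a\<close> strictly inside the window is
  \<open>N + 2 * 3 ^ a\<close>. It and its translate \<open>N + 3 ^ a\<close> both have valuation
  \<open>a\<close>, because \<open>3 ^ Suc a\<close> divides \<open>N\<close>.\<close>

lemma multiplicity_3_shift:
  fixes a j i :: nat
  defines "N \<equiv> 3 ^ Suc a * j"
  assumes "N + 3 ^ a < i" "i < N + 3 * 3 ^ a"
  shows "multiplicity 3 (i - 3 ^ a) = multiplicity 3 i"
proof (cases "3 ^ a dvd i")
  case False
  have i: "i = (i - 3 ^ a) + 3 ^ a * 1" using assms by simp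
  have "\<not> 3 ^ a dvd i - 3 ^ a"
    using False i by (metis dvd_add dvd_triv_left)
  from multiplicity_add_power_mult[OF this, of 1] i show ?thesis by simp
next
  case True
  then obtain m where m: "i = 3 ^ a * m" ..
  have "3 ^ a * (3 * j + 1) < 3 ^ a * m" "3 ^ a * m < 3 ^ a * (3 * j + 3)"
    using assms m by (simp_all add: algebra_simps)
  then have "3 * j + 1 < m" "m < 3 * j + 3"
    by (simp_all only: mult_less_cancel1)
  then have m': "m = 3 * j + 2" by simp
  have "i - 3 ^ a = 3 ^ a * (3 * j + 1)" by (simp add: m m' algebra_simps)
  moreover have "multiplicity 3 (3 ^ a * (3 * j + 1)) = a" "multiplicity 3 (3 ^ a * (3 * j + 2)) = a"
    by (rule multiplicity_power_mult_eq; presburger)+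
  ultimately show ?thesis by (simp only: m m')
qed

lemma poly_to_laurent_monom: "poly_to_laurent (monom c n) = fls_const c * fls_X_inv ^ n"
  by (induction n) (simp_all add: monom_0 monom_Suc algebra_simps)

text \<open>Periodicity on the window removes from \<open>\<xi> ^ (r ^ s) - \<xi>\<close> all
  exponents strictly between \<open>A\<close> and \<open>A * r ^ (2 * s)\<close>. Multiplying by
  \<open>T ^ A\<close> and dropping the polynomial part leaves a tail of valuation at least
  \<open>A * (r ^ (2 * s) - 1)\<close>.\<close>

lemma ternary_lacunary_approximation:
  fixes f :: "nat \<Rightarrow> bool" and a j :: nat
  assumes char: "prime CHAR('a::field)" and f: "\<exists>b>a. f b \<noteq> f a"
  defines "s \<equiv> 3 ^ a" and "r \<equiv> CHAR('a)"
  defines "A \<equiv> r ^ (3 ^ Suc a * j + s)" and "\<xi> \<equiv> ternary_lacunary f :: 'a fls"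
  obtains P where "degree P \<le> r ^ s" "coeff P (r ^ s) = monom 1 A"
    "\<And>i. degree (coeff P i) \<le> A" "eval_laurent P \<xi> \<noteq> 0"
    "vanishes_below (int A * (int r ^ (2 * s) - 1)) (eval_laurent P \<xi>)"
proof -
  define e where "e i = f (multiplicity 3 i)" for i :: nat
  have r1: "r > 1" using char prime_gt_1_nat by (simp add: r_def)
  have s: "s > 0" by (simp add: s_def)
  have \<xi>: "\<xi> = lacunary r e" by (simp add: \<xi>_def ternary_lacunary_def r_def e_def[abs_def])
  define y where "y = \<xi> ^ (r ^ s) - \<xi>"
  have y: "y = lacunary r (\<lambda>i. s < i \<and> e (i - s)) - lacunary r e"
    unfolding y_def \<xi> by (simp add: lacunary_power_CHAR[OF char r_def[THEN meta_eq_to_obj_eq]])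
  have y_neg: "y $$ k = 0" if "k < 0" for k
  proof -
    have "lacunary r e' $$ k = (0 :: 'a)" for e'
      using that vanishes_below_lacunary[where 'a = 'a and r = r and e = e'] by (simp add: vanishes_below_def)
    then show ?thesis by (simp add: y)
  qed
  \<comment> \<open>The polynomial part of \<open>T ^ A * y\<close>; no \<open>k > A\<close> occurs
    because \<open>y\<close> has no positive powers of \<open>T\<close>.\<close>
  define b where "b = (\<Sum>k\<le>A. monom (y $$ (int A - int k)) k)"
  have b: "coeff b k = (if k \<le> A then y $$ (int A - int k) else 0)" for k
    unfolding b_def by (simp add: coeff_sum)
  define P where "P = monom (monom 1 A) (r ^ s) + monom (- monom 1 A) 1 + monom (- b) 0"
  have rs: "r ^ s > 1" using r1 s by (rule one_less_power)
  have eval: "eval_laurent P \<xi> $$ k = (if k > 0 then y $$ (k + int A) else 0)" for k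
  proof -
    have "eval_laurent P \<xi> = fls_X_inv ^ A * y - poly_to_laurent b"
      by (simp add: P_def y_def poly_to_laurent_monom algebra_simps)
    then have "eval_laurent P \<xi> $$ k = y $$ (k + int A) - poly_to_laurent b $$ k"
      by (simp add: fls_X_inv_power_times_conv_shift)
    then show ?thesis
      using y_neg[of "k + int A"] by (auto simp: poly_to_laurent_nth b add.commute)
  qed
  show thesis
  proof
    show "degree P \<le> r ^ s" unfolding P_def
      using rs r1 by (intro degree_add_le) (auto intro: le_trans[OF degree_monom_le])
    show "coeff P (r ^ s) = monom 1 A" using rs r1 by (simp add: P_def)
    have "degree b \<le> A" by (rule degree_le) (simp add: b)
    then show "degree (coeff P i) \<le> A" for i
      using r1 by (auto simp: P_def degree_monom_eq intro!: degree_add_le)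
    show "vanishes_below (int A * (int r ^ (2 * s) - 1)) (eval_laurent P \<xi>)"
      unfolding vanishes_below_def
    proof (intro allI impI)
      fix k assume k: "k < int A * (int r ^ (2 * s) - 1)"
      have "y $$ (k + int A) = 0" if "k > 0"
      proof -
        have "k + int A < int (A * r ^ (2 * s))" using k by (simp add: algebra_simps)
        also have "A * r ^ (2 * s) = r ^ (3 ^ Suc a * j + 3 * s)"
          by (simp add: A_def add_ac flip: power_add)
        finally have ub: "k + int A < int (r ^ (3 ^ Suc a * j + 3 * s))" .
        have "e (i - s) = e i \<and> s < i" if i: "k + int A = int (r ^ i)" for i
        proof -
          have "int A < int (r ^ i)" using i \<open>k > 0\<close> by linarith
          then have "r ^ (3 ^ Suc a * j + s) < r ^ i" unfolding A_def of_nat_less_iff .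
          moreover have "r ^ i < r ^ (3 ^ Suc a * j + 3 * s)" using ub unfolding i of_nat_less_iff .
          ultimately have "3 ^ Suc a * j + s < i" "i < 3 ^ Suc a * j + 3 * s"
            using r1 by (simp_all only: power_strict_increasing_iff)
          with multiplicity_3_shift[of a j i] show ?thesis by (simp add: e_def s_def)
        qed
        then have "(\<exists>i\<ge>1. k + int A = int (r ^ i) \<and> s < i \<and> e (i - s)) \<longleftrightarrow>
          (\<exists>i\<ge>1. k + int A = int (r ^ i) \<and> e i)" by blast
        then show ?thesis unfolding y by (simp only: fls_minus_nth lacunary_nth) simp
      qed
      then show "eval_laurent P \<xi> $$ k = 0" by (simp add: eval)
    qed
    show "eval_laurent P \<xi> \<noteq> 0"
    proof
      assume 0: "eval_laurent P \<xi> = 0"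
      obtain b where b: "a < b" "f b \<noteq> f a" using f by blast
      define x where "x = 3 ^ Suc a * j + s"
      \<comment> \<open>An index of valuation \<open>b\<close> beyond the window. Since
        \<open>a < b\<close>, its translate \<open>i - s\<close> has valuation \<open>a\<close>, so
        the coefficient of \<open>y\<close> at \<open>r ^ i\<close> survives.\<close>
      define i where "i = 3 ^ b * (3 * x + 1)"
      have "1 * (3 * x + 1) \<le> i" unfolding i_def by (rule mult_le_mono1) simp
      then have i: "x < i" "s < i" unfolding x_def by auto
      have "multiplicity 3 i = b"
        unfolding i_def by (rule multiplicity_power_mult_eq) presburger+
      moreover have "multiplicity 3 (i - s) = a"
      proof -
        obtain d where d: "b = Suc a + d" using b(1) less_imp_Suc_add by auto
        have "i - s = 3 ^ a * (3 * (3 ^ d * (3 * x + 1)) - 1)"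
          by (simp add: i_def s_def d power_add algebra_simps diff_mult_distrib2)
        moreover have "\<not> 3 dvd 3 * z - 1" if "z > 0" for z :: nat using that by presburger
        from multiplicity_power_mult_eq[OF _ this, of "3 ^ d * (3 * x + 1)" a]
        have "multiplicity 3 (3 ^ a * (3 * (3 ^ d * (3 * x + 1)) - 1)) = a" by simp
        ultimately show ?thesis by (simp only:)
      qed
      ultimately have "e (i - s) \<noteq> e i" using b by (simp add: e_def)
      then have "y $$ int (r ^ i) \<noteq> 0"
        using i r1 unfolding y by (simp add: lacunary_nth_power del: of_nat_power)
      moreover have "r ^ x < r ^ i" using i r1 by simp
      then have "int (r ^ i) - int A > 0" unfolding A_def x_def by linarith
      ultimately have "eval_laurent P \<xi> $$ (int (r ^ i) - int A) \<noteq> 0"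
        by (simp add: eval)
      with 0 show False by simp
    qed
  qed
qed

section \<open>Heights and the lower bound for the exponents\<close>

lemma height_le_power:
  assumes "\<And>i. degree (coeff P i) \<le> A"
  shows "height (P :: 'a::{field,finite} poly poly) \<le> real CARD('a) ^ A"
proof -
  have "real CARD('a) \<ge> 1" using one_less_CARD[where 'a = 'a] by simp
  then show ?thesis unfolding height_def
    by (subst Max_le_iff) (auto simp: laurent_abs_poly_to_laurent assms intro!: power_increasing)
qed

lemma height_ge:
  assumes "coeff P i \<noteq> 0"
  shows "real CARD('a) ^ degree (coeff P i) \<le> height (P :: 'a::{field,finite} poly poly)"
proof -
  have "laurent_abs (poly_to_laurent (coeff P i)) \<le> height P"
    unfolding height_def using assms by (intro Max_ge) (auto simp: le_degree)
  with assms show ?thesis by (simp add: laurent_abs_poly_to_laurent)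
qed

lemma laurent_abs_pos_iff: "0 < laurent_abs (x :: 'a::{field,finite} fls) \<longleftrightarrow> x \<noteq> 0"
  by (simp add: laurent_abs_def)

lemma power_powr_minus:
  assumes "c > (0::real)"
  shows "(c ^ A) powr (- w) = c powr (- (real A * w))"
  using assms by (simp add: powr_powr flip: powr_realpow)

text \<open>Each \<open>j\<close> gives a window and hence an approximating polynomial of height at
  most \<open>q ^ A j\<close>, where \<open>q\<close> is \<open>CARD('a)\<close>. The coefficients
  \<open>T ^ A j\<close> of \<open>X ^ m\<close> make these polynomials distinct.\<close>

lemma mahler_w_ternary_lacunary_ge:
  fixes f :: "nat \<Rightarrow> bool" and a :: nat
  assumes char: "prime CHAR('a::{field,finite})" and f: "\<exists>b>a. f b \<noteq> f a"
  defines "m \<equiv> CHAR('a) ^ 3 ^ a"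
  shows "ereal (real m ^ 2 - 1) \<le> mahler_w m (ternary_lacunary f :: 'a fls)"
proof -
  define r where "r = CHAR('a)"
  define \<xi> where "\<xi> = (ternary_lacunary f :: 'a fls)"
  define w where "w = real m ^ 2 - 1"
  have r1: "r > 1" using char prime_gt_1_nat by (simp add: r_def)
  have c1: "real CARD('a) > 1" using one_less_CARD[where 'a = 'a] by simp
  define A where "A j = r ^ (3 ^ Suc a * j + 3 ^ a)" for j
  have m2: "real m ^ 2 = real r ^ (2 * 3 ^ a)"
    by (simp add: m_def r_def mult.commute flip: power_mult)
  have "\<forall>j. \<exists>P. degree P \<le> m \<and> coeff P m = monom 1 (A j) \<and> (\<forall>i. degree (coeff P i) \<le> A j) \<and>
    eval_laurent P \<xi> \<noteq> 0 \<and>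
    vanishes_below (int (A j) * (int r ^ (2 * 3 ^ a) - 1)) (eval_laurent P \<xi>)"
    using ternary_lacunary_approximation[OF char f] unfolding m_def A_def r_def \<xi>_def by metis
  then obtain P where P: "\<And>j. degree (P j) \<le> m" "\<And>j. coeff (P j) m = monom 1 (A j)"
    "\<And>j i. degree (coeff (P j) i) \<le> A j" "\<And>j. eval_laurent (P j) \<xi> \<noteq> 0"
    "\<And>j. vanishes_below (int (A j) * (int r ^ (2 * 3 ^ a) - 1)) (eval_laurent (P j) \<xi>)"
    by metis
  have "inj P"
  proof (rule injI)
    fix j k assume "P j = P k"
    then have "degree (monom (1::'a) (A j)) = degree (monom (1::'a) (A k))" using P(2) by metis
    then have "A j = A k" by (simp add: degree_monom_eq)
    then show "j = k" using r1 by (simp add: A_def power_inject_exp)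
  qed
  moreover have "laurent_abs (eval_laurent (P j) \<xi>) \<le> height (P j) powr (- w)" for j
  proof -
    have "real_of_int (int (A j) * (int r ^ (2 * 3 ^ a) - 1)) \<le> fls_subdegree (eval_laurent (P j) \<xi>)"
      using P(4,5)[of j] unfolding vanishes_below_iff of_int_le_iff by blast
    then have "real (A j) * w \<le> fls_subdegree (eval_laurent (P j) \<xi>)"
      by (simp add: w_def m2)
    then have "laurent_abs (eval_laurent (P j) \<xi>) \<le> (real CARD('a) ^ A j) powr (- w)"
      using c1 by (simp add: laurent_abs_le_iff power_powr_minus)
    \<comment> \<open>As \<open>- w \<le> 0\<close>, the upper bound on the height suffices once the
      height is known to be positive.\<close>
    also have "\<dots> \<le> height (P j) powr (- w)"
    proof (rule powr_mono2')
      show "- w \<le> 0" using r1 by (simp add: w_def m2)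
      have "0 < real CARD('a) ^ degree (coeff (P j) m)" using c1 by simp
      also have "\<dots> \<le> height (P j)" by (rule height_ge) (simp add: P(2))
      finally show "0 < height (P j)" .
    qed (rule height_le_power, rule P)
    finally show ?thesis .
  qed
  ultimately have "infinite {P. degree P \<le> m \<and> 0 < laurent_abs (eval_laurent P \<xi>) \<and>
     laurent_abs (eval_laurent P \<xi>) \<le> height P powr (- w)}"
    using P(1,4) by (intro infinite_super[OF _ range_inj_infinite]) (auto simp: laurent_abs_pos_iff)
  then show ?thesis unfolding mahler_w_def \<xi>_def[symmetric] w_def[symmetric]
    by (intro Sup_upper CollectI exI[of _ w] conjI refl)
qed

text \<open>Along the degrees \<open>m = r ^ (3 ^ a)\<close>, with \<open>r\<close> the
  characteristic, the quotient is at least \<open>m - 1\<close>, which is unbounded.\<close>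

lemma mahler_w_lim_ternary_lacunary:
  fixes f :: "nat \<Rightarrow> bool"
  assumes char: "prime CHAR('a::{field,finite})" and f: "\<And>a. \<exists>b>a. f b \<noteq> f a"
  shows "mahler_w_lim (ternary_lacunary f :: 'a fls) = \<infinity>"
proof (rule ccontr)
  let ?w = "\<lambda>n. mahler_w n (ternary_lacunary f :: 'a fls) / ereal (real n)"
  assume "mahler_w_lim (ternary_lacunary f :: 'a fls) \<noteq> \<infinity>"
  then obtain C where "limsup ?w < ereal (real C)"
    unfolding mahler_w_lim_def by (auto simp: less_PInf_Ex_of_nat less_top)
  then have "eventually (\<lambda>n. ?w n < ereal (real C)) sequentially" by (rule Limsup_lessD)
  then obtain M where M: "\<And>n. n \<ge> M \<Longrightarrow> ?w n < ereal (real C)"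
    unfolding eventually_sequentially by blast
  \<comment> \<open>Since \<open>m > a\<close>, this makes \<open>m\<close> exceed both the
    threshold \<open>M\<close> and \<open>C + 1\<close>.\<close>
  define a where "a = C + M + 1"
  define m where "m = CHAR('a) ^ 3 ^ a"
  have "CHAR('a) > 1" using char prime_gt_1_nat by simp
  then have m: "m > a"
    using power_gt_expt[of "CHAR('a)" "3 ^ a"] power_gt_expt[of 3 a] by (simp add: m_def)
  have "real m - 1 \<le> (real m ^ 2 - 1) / real m"
    using m by (simp add: field_simps power2_eq_square)
  then have "ereal (real m - 1) \<le> ereal (real m ^ 2 - 1) / ereal (real m)"
    using m by simp
  also have "\<dots> \<le> ?w m"
    using m mahler_w_ternary_lacunary_ge[OF char f, of a] unfolding m_def[symmetric]
    by (intro ereal_divide_right_mono) auto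
  also have "\<dots> < ereal (real C)" using m by (intro M) (simp add: a_def)
  finally show False using m by (simp add: a_def)
qed

section \<open>Finiteness of the exponents\<close>

text \<open>The windows of length \<open>n\<close> around \<open>N\<close> and \<open>N'\<close> agree except at \<open>N\<close> and \<open>N'\<close>, so the
  two values of the linear form at offset \<open>l0\<close> differ by the coefficient \<open>x l0\<close>.\<close>
lemma no_linear_recurrence:
  fixes f :: "nat \<Rightarrow> bool" and x :: "nat \<Rightarrow> 'b::ab_group_add"
  assumes n: "n < 3 ^ a" and b: "a < b" "f b \<noteq> f a" and l0: "l0 \<le> n" "x l0 \<noteq> 0"
  shows "\<exists>i>i0. n < i \<and> i \<le> i0 + 2 * 3 ^ Suc b + n \<and>
    (\<Sum>l\<le>n. if f (multiplicity 3 (i - l)) then x l else 0) \<noteq> 0"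
proof -
  \<comment> \<open>\<open>M\<close> is the first multiple of \<open>3 ^ Suc b\<close> beyond
    \<open>i0\<close>, so \<open>M + 3 ^ a\<close> and \<open>M + 3 ^ b\<close> have valuations
    \<open>a\<close> and \<open>b\<close>.\<close>
  define v :: nat where "v = i0 div 3 ^ Suc b + 1"
  define M where "M = 3 ^ Suc b * v"
  have M: "i0 < M" "M \<le> i0 + 3 ^ Suc b"
    using dividend_less_times_div[of "3 ^ Suc b" i0] times_div_less_eq_dividend[of "3 ^ Suc b" i0]
    by (simp_all add: M_def v_def algebra_simps)
  define N N' where "N = M + 3 ^ a" and "N' = M + 3 ^ b"
  define G where "G i = (\<Sum>l\<le>n. if f (multiplicity 3 (i - l)) then x l else 0)" for i
  obtain d where d: "b = Suc a + d" using b(1) less_imp_Suc_add by auto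
  have N_eq: "N = 3 ^ a * (3 * (3 * 3 ^ d * v) + 1)" "N' = 3 ^ b * (3 * v + 1)"
    by (simp_all add: N_def N'_def M_def d power_add algebra_simps)
  have mult: "multiplicity 3 N = a" "multiplicity 3 N' = b"
    unfolding N_eq by (rule multiplicity_power_mult_eq; presburger)+
  have "(3::nat) ^ a \<le> 3 ^ b" using b by (intro power_increasing) auto
  then have N: "N \<le> N'" "n < N" "i0 < N" "N' \<le> i0 + 2 * 3 ^ Suc b"
    using n M by (simp_all add: N_def N'_def)
  have eq: "multiplicity 3 (N' + l0 - l) = multiplicity 3 (N + l0 - l)" if l: "l \<le> n" "l \<noteq> l0" for l
  proof -
    \<comment> \<open>\<open>3 ^ a\<close> divides \<open>N\<close>, but \<open>l\<close> and
      \<open>l0\<close> are distinct and differ by at most \<open>n < 3 ^ a\<close>.\<close>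
    have "\<not> 3 ^ a dvd N + l0 - l"
    proof
      assume *: "3 ^ a dvd N + l0 - l"
      have dvd: "3 ^ a dvd N" unfolding N_eq by simp
      show False
      proof (cases "l < l0")
        case True
        with * have "3 ^ a dvd N + (l0 - l)" by simp
        then have "3 ^ a dvd l0 - l" using dvd by (simp add: dvd_add_right_iff)
        with True have "3 ^ a \<le> l0 - l" by (intro dvd_imp_le) auto
        with n l0 show False by linarith
      next
        case False
        have "3 ^ a dvd N - (N + l0 - l)" using dvd * by (rule dvd_diff_nat)
        moreover have "N - (N + l0 - l) = l - l0" using False l N by simp
        ultimately have "3 ^ a \<le> l - l0" using False l by (intro dvd_imp_le) auto
        with n l show False by linarith
      qed
    qed
    moreover have "N' + l0 - l = (N + l0 - l) + 3 ^ a * (3 ^ Suc d - 1)"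
      using l N by (simp add: N_def N'_def d power_add algebra_simps diff_mult_distrib2)
    ultimately show ?thesis by (metis multiplicity_add_power_mult)
  qed
  have "G (N' + l0) - G (N + l0) = (\<Sum>l\<le>n. if l = l0 then if f b then x l0 else - x l0 else 0)"
    unfolding G_def sum_subtractf[symmetric]
    by (intro sum.cong) (use b(2) in \<open>auto simp: eq mult\<close>)
  also have "\<dots> \<noteq> 0" using l0 by simp
  finally consider "G (N' + l0) \<noteq> 0" | "G (N + l0) \<noteq> 0" by fastforce
  then show ?thesis
  proof cases
    case 1
    with N l0 show ?thesis by (intro exI[of _ "N' + l0"]) (auto simp: G_def)
  next
    case 2
    with N l0 show ?thesis by (intro exI[of _ "N + l0"]) (auto simp: G_def)
  qed
qed

text \<open>A nonzero coefficient is found at \<open>r ^ i - t0\<close>, with \<open>i\<close>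
  within a bounded distance of the place where blocks separate. The bound is linear in
  \<open>D\<close>, as a finite exponent requires.\<close>

lemma additive_ternary_lacunary_subdegree:
  fixes f :: "nat \<Rightarrow> bool"
  assumes char: "prime CHAR('a::field)" and r: "r = CHAR('a)"
    and n: "n < 3 ^ a" and b: "a < b" "f b \<noteq> f a"
    and c: "\<And>l. degree (c l :: 'a poly) \<le> D" "\<exists>l\<le>n. c l \<noteq> 0"
  defines "L \<equiv> \<Sum>l\<le>n. poly_to_laurent (c l) * ternary_lacunary f ^ (r ^ l)"
  shows "L \<noteq> 0" "fls_subdegree L \<le> int ((D + 1) * r ^ (1 + 2 * 3 ^ Suc b + n))"
proof -
  have r1: "r > 1" using char r prime_gt_1_nat by simp
  obtain l0 where l0: "l0 \<le> n" "c l0 \<noteq> 0" using c by blast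
  define t0 where "t0 = degree (c l0)"
  have t0: "t0 \<le> D" using c by (simp add: t0_def)
  \<comment> \<open>The base \<open>r\<close> logarithm of \<open>D + 1\<close>: indices beyond
    \<open>k + 1\<close> have separate blocks, while \<open>r ^ k \<le> D + 1\<close> keeps the
    estimate linear.\<close>
  obtain k where k: "r ^ k \<le> D + 1" "D + 1 < r ^ (k + 1)"
    using ex_power_ivl1[of r "D + 1"] r1 by auto
  obtain i where i: "k + 1 < i" "n < i" "i \<le> k + 1 + 2 * 3 ^ Suc b + n"
    "(\<Sum>l\<le>n. if f (multiplicity 3 (i - l)) then coeff (c l) t0 else 0) \<noteq> 0"
    using no_linear_recurrence[of n a b f l0 "\<lambda>l. coeff (c l) t0" "k + 1"] n b l0
    by (auto simp: t0_def)
  have "r ^ (k + 1) \<le> r ^ (i - 1)" using i r1 by (intro power_increasing) auto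
  with k have "D < r ^ (i - 1)" by linarith
  from additive_lacunary_nth[OF char r c(1) this i(2) t0] i(4)
  have nz: "L $$ (int (r ^ i) - int t0) \<noteq> 0"
    unfolding L_def ternary_lacunary_def r[symmetric] by simp
  then show "L \<noteq> 0" by auto
  have "fls_subdegree L \<le> int (r ^ i)" using nz by (rule fls_subdegree_leI') simp
  also have "r ^ i \<le> r ^ k * r ^ (1 + 2 * 3 ^ Suc b + n)"
    unfolding power_add[symmetric] using i r1 by (intro power_increasing) auto
  also have "\<dots> \<le> (D + 1) * r ^ (1 + 2 * 3 ^ Suc b + n)"
    using k by (intro mult_le_mono1)
  finally show "fls_subdegree L \<le> int ((D + 1) * r ^ (1 + 2 * 3 ^ Suc b + n))" by simp
qed

text \<open>An additive multiple \<open>u * L = P * S\<close> transfers the estimate from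
  \<open>L\<close> to \<open>P\<close>, because the valuation of \<open>S\<close> at the series is
  bounded below by its coefficient degrees.\<close>

lemma eval_ternary_lacunary_subdegree:
  fixes f :: "nat \<Rightarrow> bool"
  assumes char: "prime CHAR('a::{field,finite})" and f: "\<And>a. \<exists>b>a. f b \<noteq> f a"
  obtains C :: nat where "\<And>(P :: 'a poly poly) h. degree P \<le> n \<Longrightarrow>
    (\<And>i. degree (coeff P i) \<le> h) \<Longrightarrow> h \<ge> 1 \<Longrightarrow>
    fls_subdegree (eval_laurent P (ternary_lacunary f)) \<le> int (C * h)"
proof -
  define r where "r = CHAR('a)"
  have r0: "r > 0" using char prime_gt_0_nat by (simp add: r_def)
  define \<xi> where "\<xi> = (ternary_lacunary f :: 'a fls)"
  \<comment> \<open>The level \<open>a = n\<close> is admissible for the additive estimate, since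
    \<open>n < 3 ^ n\<close>.\<close>
  obtain b where b: "n < b" "f b \<noteq> f n" using f by blast
  define G where "G = r ^ (1 + 2 * 3 ^ Suc b + n)"
  define K where "K = r ^ n"
  show thesis
  proof
    fix P :: "'a poly poly" and h :: nat
    assume P: "degree P \<le> n" "\<And>i. degree (coeff P i) \<le> h" and h: "h \<ge> 1"
    show "fls_subdegree (eval_laurent P (ternary_lacunary f)) \<le> int (((n * K + 1) * G + n * K + K) * h)"
      unfolding \<xi>_def[symmetric]
    proof (cases "degree P = 0 \<or> eval_laurent P \<xi> = 0")
      \<comment> \<open>Constants have nonpositive subdegree, and a zero value has subdegree 0 by
        convention.\<close>
      case True
      then consider p where "P = [:p:]" | "eval_laurent P \<xi> = 0" by (auto elim: degree_eq_zeroE)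
      then show "fls_subdegree (eval_laurent P \<xi>) \<le> int (((n * K + 1) * G + n * K + K) * h)"
        by cases (auto intro: order_trans[of _ 0])
    next
      case False
      define E where "E = K * h"
      obtain c u S where c: "\<And>l. degree (c l) \<le> n * E" "\<exists>l\<le>n. c l \<noteq> 0" and u: "u \<noteq> 0"
        and S: "(\<Sum>l\<le>n. monom (u * c l) (r ^ l)) = P * S" "\<And>i. degree (coeff S i) \<le> n * E + E"
        using additive_multiple[of P n h r] False P r0 unfolding E_def K_def by blast
      define L where "L = (\<Sum>l\<le>n. poly_to_laurent (c l) * \<xi> ^ (r ^ l))"
      have L: "L \<noteq> 0" "fls_subdegree L \<le> int ((n * E + 1) * G)"
        using additive_ternary_lacunary_subdegree[OF char r_def power_gt_expt[of 3 n] b c]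
        unfolding L_def \<xi>_def G_def by simp_all
      have "poly_to_laurent u * L = eval_laurent (\<Sum>l\<le>n. monom (u * c l) (r ^ l)) \<xi>"
        by (simp add: L_def sum_distrib_left mult.assoc)
      also have "\<dots> = eval_laurent P \<xi> * eval_laurent S \<xi>" by (simp add: S)
      finally have eq: "poly_to_laurent u * L = eval_laurent P \<xi> * eval_laurent S \<xi>" .
      with u L have nz: "eval_laurent P \<xi> \<noteq> 0" "eval_laurent S \<xi> \<noteq> 0" by auto
      have "vanishes_below (- int (n * E + E)) (eval_laurent S \<xi>)"
        using S(2) by (rule vanishes_below_eval_laurent)
          (simp add: \<xi>_def ternary_lacunary_def vanishes_below_lacunary)
      then have "- int (n * E + E) \<le> fls_subdegree (eval_laurent S \<xi>)"
        using nz unfolding vanishes_below_iff by blast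
      moreover have "fls_subdegree (eval_laurent P \<xi>) + fls_subdegree (eval_laurent S \<xi>)
        = fls_subdegree L - int (degree u)"
        using arg_cong[OF eq, of fls_subdegree] nz u L by simp
      ultimately have "fls_subdegree (eval_laurent P \<xi>) \<le> int ((n * E + 1) * G + n * E + E)"
        using L by linarith
      also have "(n * E + 1) * G + n * E + E \<le> ((n * K + 1) * G + n * K + K) * h"
        using h by (simp add: E_def algebra_simps)
      finally show "fls_subdegree (eval_laurent P \<xi>) \<le> int (((n * K + 1) * G + n * K + K) * h)"
        by simp
    qed
  qed
qed

text \<open>For height at most 1 the powers of the height say nothing about \<open>w\<close>, but
  these finitely many polynomials can be discarded from an infinite set.\<close>

lemma finite_constant_coeffs:
  "finite {P :: 'a::{field,finite} poly poly. degree P \<le> n \<and> (\<forall>i. degree (coeff P i) = 0)}"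
proof (rule finite_subset)
  show "{P :: 'a poly poly. degree P \<le> n \<and> (\<forall>i. degree (coeff P i) = 0)}
    \<subseteq> map_poly (\<lambda>c. [:c:]) ` {p. degree p \<le> n}"
  proof
    fix P :: "'a poly poly" assume P: "P \<in> {P. degree P \<le> n \<and> (\<forall>i. degree (coeff P i) = 0)}"
    let ?p = "map_poly (\<lambda>q. coeff q 0) P"
    have "P = map_poly (\<lambda>c. [:c:]) ?p"
    proof (rule poly_eqI)
      fix i
      obtain c where "coeff P i = [:c:]" using P by (blast elim: degree_eq_zeroE)
      then show "coeff P i = coeff (map_poly (\<lambda>c. [:c:]) ?p) i" by (simp add: coeff_map_poly)
    qed
    moreover have "degree ?p \<le> n" using P map_poly_degree_leq[of "\<lambda>q. coeff q 0" P] by simp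
    ultimately show "P \<in> map_poly (\<lambda>c. [:c:]) ` {p. degree p \<le> n}" by blast
  qed
qed (simp add: finite_card_degree_le)

text \<open>If \<open>h \<ge> 1\<close> is the largest coefficient degree of \<open>P\<close>, a
  nonzero value has valuation at most \<open>C * h\<close>, whereas an exponent
  \<open>w \<ge> 0\<close> demands at least \<open>w * h\<close>. Hence no \<open>w > C\<close> is
  attained infinitely often.\<close>

lemma mahler_w_ternary_lacunary_less:
  fixes f :: "nat \<Rightarrow> bool"
  assumes char: "prime CHAR('a::{field,finite})" and f: "\<And>a. \<exists>b>a. f b \<noteq> f a"
  shows "mahler_w n (ternary_lacunary f :: 'a fls) < \<infinity>"
proof -
  define \<xi> where "\<xi> = (ternary_lacunary f :: 'a fls)"
  obtain C :: nat where C: "\<And>(P :: 'a poly poly) h. degree P \<le> n \<Longrightarrow>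
    (\<And>i. degree (coeff P i) \<le> h) \<Longrightarrow> h \<ge> 1 \<Longrightarrow> fls_subdegree (eval_laurent P \<xi>) \<le> int (C * h)"
    using eval_ternary_lacunary_subdegree[OF char f] unfolding \<xi>_def by blast
  have c1: "real CARD('a) > 1" using one_less_CARD[where 'a = 'a] by simp
  have "w \<le> real C" if inf: "infinite {P :: 'a poly poly. degree P \<le> n \<and>
     0 < laurent_abs (eval_laurent P \<xi>) \<and> laurent_abs (eval_laurent P \<xi>) \<le> height P powr (- w)}" for w
  proof (rule ccontr)
    assume w: "\<not> w \<le> real C"
    from inf finite_constant_coeffs[of n] obtain P :: "'a poly poly" where
      P: "degree P \<le> n" "eval_laurent P \<xi> \<noteq> 0" "laurent_abs (eval_laurent P \<xi>) \<le> height P powr (- w)"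
      and "\<exists>i. degree (coeff P i) \<noteq> 0"
      by (smt (verit, best) finite_subset laurent_abs_pos_iff mem_Collect_eq subsetI)
    then obtain i0 where i0: "degree (coeff P i0) > 0" by auto
    define h where "h = Max ((\<lambda>i. degree (coeff P i)) ` {..degree P})"
    have le_h: "degree (coeff P i) \<le> h" for i
    proof (cases "i \<le> degree P")
      case True
      then show ?thesis unfolding h_def by (intro Max_ge) auto
    qed (simp add: coeff_eq_0)
    have "h \<in> (\<lambda>i. degree (coeff P i)) ` {..degree P}"
      unfolding h_def by (rule Max_in) auto
    then obtain i where i: "degree (coeff P i) = h" by blast
    have h: "h \<ge> 1" using le_h[of i0] i0 by simp
    have "coeff P i \<noteq> 0" using i h by auto
    from height_ge[OF this] have "real CARD('a) ^ h \<le> height P" by (simp add: i)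
    then have "height P powr (- w) \<le> (real CARD('a) ^ h) powr (- w)"
      using w c1 by (intro powr_mono2') auto
    with P(3) have "laurent_abs (eval_laurent P \<xi>) \<le> real CARD('a) powr (- (real h * w))"
      using c1 by (simp add: power_powr_minus)
    with P(2) have "real h * w \<le> fls_subdegree (eval_laurent P \<xi>)"
      by (simp only: laurent_abs_le_iff simp_thms)
    also have "\<dots> \<le> real_of_int (int (C * h))"
      using C[OF P(1) le_h h] by (simp only: of_int_le_iff)
    also have "\<dots> = real h * real C" by simp
    finally show False using w h by simp
  qed
  then have "mahler_w n \<xi> \<le> ereal (real C)"
    unfolding mahler_w_def by (intro Sup_least) auto
  then show ?thesis unfolding \<xi>_def by (rule le_less_trans) simp
qed

section \<open>Embedding the sets of natural numbers\<close>

theorem theorem1p1: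
  fixes p q :: nat
  assumes "prime p"
    and "\<exists>k\<ge>1. q = p ^ k"
    and "CARD('a::{field,finite}) = q"
  shows "uncountable {\<xi> :: 'a fls. T_number \<xi>}"
proof -
  have char: "prime CHAR('a)" by (rule prime_CHAR_semidom[OF finite_imp_CHAR_pos]) simp
  then have char1: "CHAR('a) > 1" using prime_gt_1_nat by blast
  \<comment> \<open>The value at \<open>2 * k\<close> records whether \<open>k\<close> is in
    \<open>A\<close> and the value at \<open>2 * k + 1\<close> is its negation, so
    \<open>f A\<close> is never eventually constant.\<close>
  define f where "f A m = ((m div 2 \<in> A) = even m)" for A :: "nat set" and m :: nat
  have f: "\<exists>b>a. f A b \<noteq> f A a" for A a
  proof -
    have "f A (2 * Suc a) \<noteq> f A (2 * Suc a + 1)" by (simp add: f_def)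
    then consider "f A (2 * Suc a) \<noteq> f A a" | "f A (2 * Suc a + 1) \<noteq> f A a" by blast
    then show ?thesis
      by cases (intro exI[of _ "2 * Suc a"], simp, intro exI[of _ "2 * Suc a + 1"], simp)
  qed
  let ?\<xi> = "\<lambda>A. ternary_lacunary (f A) :: 'a fls"
  have T: "range ?\<xi> \<subseteq> {\<xi>. T_number \<xi>}"
    unfolding T_number_def
    using mahler_w_lim_ternary_lacunary[OF char f] mahler_w_ternary_lacunary_less[OF char f] by auto
  have "inj ?\<xi>"
  proof (rule injI, rule set_eqI)
    fix A B :: "nat set" and m
    assume eq: "?\<xi> A = ?\<xi> B"
    \<comment> \<open>The index \<open>3 ^ (2 * m)\<close> has valuation \<open>2 * m\<close>, so
      this coefficient recovers membership of \<open>m\<close>.\<close>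
    have nth: "?\<xi> A $$ int (CHAR('a) ^ 3 ^ (2 * m)) = (if m \<in> A then 1 else 0)" for A
      unfolding ternary_lacunary_def
      by (subst lacunary_nth_power) (use char1 in \<open>simp_all add: f_def\<close>)
    show "m \<in> A \<longleftrightarrow> m \<in> B" using nth[of A] nth[of B] eq by (auto split: if_splits)
  qed
  moreover have "uncountable (UNIV :: nat set set)"
    using Cantors_theorem[of "UNIV :: nat set"] by (auto simp: uncountable_def)
  ultimately have "uncountable (range ?\<xi>)" by (simp add: countable_image_inj_eq)
  with T show ?thesis using countable_subset by blast
qed

end
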